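(* Let $v_L=(u_L,\sigma_L)$ and $v_R=(u_R,\sigma_R)$ in $\mathbb{R}^2$ be given states with $u_L\neq u_R$, and let $\phi=(\phi_1,\phi_2)$ be a DLM path. Let $A(u,\sigma)=\begin{pmatrix} u & -1\\ 0 & u\end{pmatrix}$ be the coefficient matrix of the system $u_t+uu_x-\sigma_x=0,\ \sigma_t+u\sigma_x=0$, and put $$s=\frac{[\frac{u^2}{2}]-[\sigma]}{[u]}.$$ If $$\int_0^1 \phi_1(t;u_L,u_R)\,(\phi_2)_t(t;\sigma_L,\sigma_R)\,dt=[\sigma]\cdot\frac{[\frac{u^2}{2}]-[\sigma]}{[u]},$$ then the Rankine-Hugoniot condition $$\int_0^1\{-s\,\mathrm{Id}+A(\phi(t;v_L,v_R))\}\,\phi_t(t;v_L,v_R)\,dt=0$$ is satisfied, with $s$ as the speed of the shock.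
   Context: Jumps: $[u]=u_R-u_L$, $[\sigma]=\sigma_R-\sigma_L$, $[\frac{u^2}{2}]=\frac{u_R^2}{2}-\frac{u_L^2}{2}$. $\mathrm{Id}$ is the $2\times 2$ identity matrix, and the subscript $t$ on a path denotes the derivative in its first argument $t$ (existing for almost every $t$). A DLM path is a locally Lipschitz map $\phi:[0,1]\times\mathbb{R}^2\times\mathbb{R}^2\to\mathbb{R}^2$ such that: (1) $\phi(0;v_L,v_R)=v_L$ and $\phi(1;v_L,v_R)=v_R$ for all $v_L,v_R\in\mathbb{R}^2$; (2) $\phi(t;v,v)=v$ for all $v\in\mathbb{R}^2$, $t\in[0,1]$; (3) for every bounded set $\Omega\subset\mathbb{R}^2$ there is $k\ge 1$ such that $|\phi_t(t;v_L,v_R)-\phi_t(t;w_L,w_R)|\le k\,|(v_L-w_L)-(v_R-w_R)|$ for all $v_L,v_R,w_L,w_R\in\Omega$ and almost every $t\in[0,1]$. The components of the path $\phi(t;v_L,v_R)$ connecting $v_L=(u_L,\sigma_L)$ to $v_R=(u_R,\sigma_R)$ are written $\phi_1(t;u_L,u_R)$ (the $u$-component) and $\phi_2(t;\sigma_L,\sigma_R)$ (the $\sigma$-component). *)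

theory Defs
  imports "HOL-Analysis.Analysis"
begin

definition locally_lipschitz_on ::
    "'a::metric_space set \<Rightarrow> ('a \<Rightarrow> 'b::metric_space) \<Rightarrow> bool" where
  "locally_lipschitz_on S f \<longleftrightarrow>
     (\<forall>x\<in>S. \<exists>e>0. \<exists>L. lipschitz_on L (cball x e \<inter> S) f)"

text \<open>
  The derivative of a path in its parameter. It exists for almost every parameter
  in the unit interval whenever the path is locally Lipschitz; on the exceptional null set
  \<^const>\<open>vector_derivative\<close> is an unspecified vector, which affects neither
  almost-everywhere statements nor integrals.
\<close>
definition path_deriv :: "(real \<Rightarrow> 'a::real_normed_vector) \<Rightarrow> real \<Rightarrow> 'a" where
  "path_deriv g t = vector_derivative g (at t within {0..1})"

definition dlm_path :: "(real \<Rightarrow> real^2 \<Rightarrow> real^2 \<Rightarrow> real^2) \<Rightarrow> bool" where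
  "dlm_path \<phi> \<longleftrightarrow>
     locally_lipschitz_on ({0..1} \<times> UNIV \<times> UNIV) (\<lambda>(t, vL, vR). \<phi> t vL vR) \<and>
     (\<forall>vL vR. \<phi> 0 vL vR = vL \<and> \<phi> 1 vL vR = vR) \<and>
     (\<forall>v. \<forall>t\<in>{0..1}. \<phi> t v v = v) \<and>
     (\<forall>\<Omega>. bounded \<Omega> \<longrightarrow>
        (\<exists>k\<ge>1. \<forall>vL\<in>\<Omega>. \<forall>vR\<in>\<Omega>. \<forall>wL\<in>\<Omega>. \<forall>wR\<in>\<Omega>.
           AE t in lebesgue_on {0..1}.
             norm (path_deriv (\<lambda>r. \<phi> r vL vR) t - path_deriv (\<lambda>r. \<phi> r wL wR) t)
               \<le> k * norm ((vL - wL) - (vR - wR))))"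

text \<open>
  States are vectors \<open>v = (u, \<sigma>)\<close> with \<open>u = v $ 1\<close> and
  \<open>\<sigma> = v $ 2\<close>; matrices are listed by rows.
\<close>
definition coeff_matrix :: "real^2 \<Rightarrow> real^2^2" where
  "coeff_matrix v = vector [vector [v $ 1, -1], vector [0, v $ 1]]"

end

theory Submission
  imports Defs
begin

text \<open>
  Along the path write \<open>x t = (x\<^sub>1 t, x\<^sub>2 t)\<close>. The integrand of the Rankine-Hugoniot condition has
  components \<open>x\<^sub>1 x\<^sub>1' - x\<^sub>2' - s x\<^sub>1'\<close> and \<open>x\<^sub>1 x\<^sub>2' - s x\<^sub>2'\<close>. The first one is the
  derivative of \<open>x\<^sub>1\<^sup>2 / 2 - x\<^sub>2 - s x\<^sub>1\<close>, so its integral is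
  \<open>[u\<^sup>2/2] - [\<sigma>] - s [u]\<close>, which vanishes by the choice of \<open>s\<close>. The second one has integral
  \<open>\<integral> x\<^sub>1 x\<^sub>2' - s [\<sigma>]\<close>, which vanishes by the hypothesis on the product
  \<open>\<integral> \<phi>\<^sub>1 (\<phi>\<^sub>2)\<^sub>t\<close>.

  A path is only Lipschitz, so this computation rests on two facts of real analysis: a Lipschitz
  function on an interval is differentiable almost everywhere, and it is recovered by
  integrating its derivative.

  Differentiability is proved first for a monotone \<open>F\<close> that is Lipschitz on the whole line; adding a
  linear function reduces the general case to this one. The Stieltjes measure of \<open>F\<close> is bounded by a multiple of
  Lebesgue measure (\<open>emeasure_le_lborel_if_le_on_intervals\<close>), so it has a Radon-Nikodym density
  \<open>f\<close>. If difference quotients of \<open>F\<close> at the points of a set exceeded \<open>f\<close> (or fell below it) by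
  a fixed factor on arbitrarily short intervals, a disjoint Vitali cover by such intervals would
  give two incompatible estimates of the measure of the cover, unless the set is negligible
  (\<open>negligible_if_measures_compare_on_small_intervals\<close>). So \<open>F' = f\<close> almost everywhere.

  The fundamental theorem (\<open>lipschitz_on_has_integral_derivative\<close>) is proved by comparing
  Henstock-Kurzweil sums: intervals tagged outside the exceptional set are controlled by the
  derivative, and those tagged in it have small total length because the set is negligible, so
  the Lipschitz bound makes their increments small as well.
\<close>

section \<open>Measures dominated by Lebesgue measure\<close>

text \<open>
  Covering an open set by non-overlapping intervals carries the bound from intervals to open
  sets; outer regularity of Lebesgue measure then carries it to Borel sets. The gauge in the
  covering lemma keeps every covering interval inside the open set.
\<close>

lemma emeasure_le_lborel_if_le_on_intervals:
  fixes M :: "real measure" and c :: real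
  assumes sets [measurable_cong, simp]: "sets M = sets borel" and "0 \<le> c"
    and le: "\<And>u v. u \<le> v \<Longrightarrow> emeasure M {u..v} \<le> ennreal (c * (v - u))"
    and B: "B \<in> sets borel"
  shows "emeasure M B \<le> ennreal c * emeasure lborel B"
proof -
  have point: "emeasure M {x} = 0" for x
    using le[of x x] by simp
  have open_le: "emeasure M (U \<inter> {-real n..real n}) \<le> ennreal c * emeasure lborel U"
    if "open U" for U and n :: nat
  proof (cases "n = 0")
    case True
    have "emeasure M (U \<inter> {0}) \<le> emeasure M {0}"
      by (rule emeasure_mono) auto
    then show ?thesis using True point[of 0] by simp
  next
    case False
    define g where "g x = (if x \<in> U then U else UNIV)" for x
    have g: "gauge g"
      using that by (auto simp: gauge_def g_def)
    obtain D where D: "countable D"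
      "\<And>K. K \<in> D \<Longrightarrow> interior K \<noteq> {} \<and> (\<exists>c d. K = cbox c (d::real))"
      "pairwise (\<lambda>A B. interior A \<inter> interior B = {}) D"
      "\<And>K. K \<in> D \<Longrightarrow> \<exists>x \<in> (U \<inter> {-real n..real n}) \<inter> K. K \<subseteq> g x"
      "U \<inter> {-real n..real n} \<subseteq> \<Union>D"
    proof -
      have S: "U \<inter> {-real n..real n} \<subseteq> cbox (-real n) (real n)" and ne: "box (-real n) (real n) \<noteq> {}"
        using False by (auto simp: box_real)
      show thesis
        using covering_lemma[OF S ne g] that by metis
    qed
    have K: "\<exists>u v. u < v \<and> K = {u..v} \<and> interior K = {u<..<v}" if "K \<in> D" for K
      using D(2)[OF that] by (force simp: cbox_interval)
    have KU: "K \<subseteq> U" if "K \<in> D" for K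
      using D(4)[OF that] by (auto simp: g_def)
    \<comment> \<open>The intervals share endpoints, so countable additivity is applied to their interiors;
      the endpoints form a countable set, which \<open>M\<close> does not charge.\<close>
    define V where "V = (\<Union>K\<in>D. interior K)"
    define C where "C = (\<Union>K\<in>D. K - interior K)"
    have "countable (K - interior K)" if "K \<in> D" for K
    proof -
      from K[OF that] obtain u v where "u < v" "K = {u..v}" "interior K = {u<..<v}" by blast
      then have "K - interior K \<subseteq> {u, v}" by auto
      then show ?thesis by (rule countable_subset) auto
    qed
    then have C: "countable C"
      unfolding C_def using D(1) by auto
    have [measurable]: "C \<in> sets borel"
      using C by (auto intro: sets.countable)
    have [measurable]: "V \<in> sets borel"
      unfolding V_def by (intro borel_open open_UN) auto
    have "emeasure M C = 0"
      using emeasure_countable_singleton[of C M] C point by (simp add: nn_integral_0_iff_AE)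
    have disj: "disjoint_family_on interior D"
      using D(3) by (auto simp: disjoint_family_on_def pairwise_def)
    have "emeasure M (U \<inter> {-real n..real n}) \<le> emeasure M (V \<union> C)"
    proof (rule emeasure_mono)
      show "U \<inter> {-real n..real n} \<subseteq> V \<union> C"
        using D(5) by (auto simp: V_def C_def)
    qed simp
    also have "\<dots> \<le> emeasure M V + emeasure M C"
      by (rule emeasure_subadditive) auto
    also have "\<dots> = (\<integral>\<^sup>+K. emeasure M (interior K) \<partial>count_space D)"
      unfolding V_def \<open>emeasure M C = 0\<close>
      using emeasure_UN_countable[OF _ D(1) disj, of M] by simp
    also have "\<dots> \<le> (\<integral>\<^sup>+K. ennreal c * emeasure lborel (interior K) \<partial>count_space D)"
    proof (rule nn_integral_mono)
      fix K assume "K \<in> space (count_space D)"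
      then obtain u v where uv: "u < v" "K = {u..v}" "interior K = {u<..<v}" using K[of K] by force
      have "emeasure M (interior K) \<le> emeasure M {u..v}"
        using uv by (intro emeasure_mono) auto
      also have "\<dots> \<le> ennreal (c * (v - u))" using le uv by simp
      also have "\<dots> = ennreal c * emeasure lborel (interior K)"
        using uv \<open>0 \<le> c\<close> by (simp add: ennreal_mult)
      finally show "emeasure M (interior K) \<le> ennreal c * emeasure lborel (interior K)" .
    qed
    also have "\<dots> = ennreal c * emeasure lborel V"
      unfolding V_def using emeasure_UN_countable[OF _ D(1) disj, of lborel]
      by (simp add: nn_integral_cmult)
    also have "\<dots> \<le> ennreal c * emeasure lborel U"
      using KU interior_subset that
      by (intro mult_left_mono emeasure_mono) (auto simp: V_def)
    finally show ?thesis .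
  qed
  have openU: "emeasure M U \<le> ennreal c * emeasure lborel U" if "open U" for U
  proof -
    have "(\<lambda>n. emeasure M (U \<inter> {-real n..real n})) \<longlonglongrightarrow> emeasure M (\<Union>n. U \<inter> {-real n..real n})"
      using that by (intro Lim_emeasure_incseq) (auto simp: incseq_def)
    moreover have "(\<Union>n. U \<inter> {-real n..real n}) = U"
    proof safe
      fix x assume "x \<in> U"
      obtain n where "\<bar>x\<bar> \<le> real n" using real_arch_simple by blast
      with \<open>x \<in> U\<close> show "x \<in> (\<Union>n. U \<inter> {-real n..real n})"
        by (intro UN_I[of n]) auto
    qed
    ultimately show ?thesis
      using open_le[OF that] by (auto intro: LIMSEQ_le_const2)
  qed
  show ?thesis
  proof (rule ennreal_le_epsilon)
    fix e :: real assume "0 < e"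
    define \<delta> where "\<delta> = e / (c + 1)"
    have "0 < \<delta>" and d: "c * \<delta> \<le> e" using \<open>0 < e\<close> \<open>0 \<le> c\<close> by (auto simp: \<delta>_def field_simps)
    obtain U where U: "open U" "B \<subseteq> U" "emeasure lborel (U - B) < \<delta>"
      using outer_regular_lborel[OF B \<open>0 < \<delta>\<close>] by blast
    have "emeasure M B \<le> emeasure M U" using U by (intro emeasure_mono) auto
    also have "\<dots> \<le> ennreal c * emeasure lborel U" by (rule openU) fact
    also have "\<dots> = ennreal c * (emeasure lborel B + emeasure lborel (U - B))"
      using U B by (subst plus_emeasure) (auto simp: Un_absorb1)
    also have "\<dots> \<le> ennreal c * (emeasure lborel B + ennreal \<delta>)"
      using U by (intro mult_left_mono add_left_mono) auto
    also have "\<dots> = ennreal c * emeasure lborel B + ennreal (c * \<delta>)"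
      using \<open>0 \<le> c\<close> \<open>0 < \<delta>\<close> by (simp add: distrib_left ennreal_mult)
    also have "\<dots> \<le> ennreal c * emeasure lborel B + ennreal e"
      using d by (intro add_left_mono ennreal_leI)
    finally show "emeasure M B \<le> ennreal c * emeasure lborel B + ennreal e" .
  qed
qed

section \<open>Comparison of measures by Vitali covers\<close>

text \<open>
  The engine of the differentiation theorem. A disjoint Vitali cover \<open>V\<close> of \<open>E\<close> by the given
  intervals satisfies \<open>P V \<le> Q V\<close>, whereas on \<open>A\<close> the measure \<open>Q\<close> is smaller than \<open>P\<close> by the
  factor \<open>\<theta> < 1\<close>. When \<open>V\<close> lies in an open set that exceeds \<open>A\<close> only by \<open>\<epsilon>\<close>, these combine to
  \<open>Q V \<le> \<theta> Q V + c \<epsilon>\<close>. Hence \<open>Q V\<close> is small, and by the lower bound \<open>\<kappa>\<close> so is the length of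
  \<open>V\<close>. The estimate goes through \<open>A\<close> because \<open>E\<close> need not be measurable.

  The symmetric form in \<open>P\<close> and \<open>Q\<close> lets one lemma treat both upper and lower difference quotients,
  with a multiple of Lebesgue measure in either of the two roles.
\<close>

lemma negligible_if_measures_compare_on_small_intervals:
  fixes P Q :: "real measure" and c \<kappa> \<theta> :: real
  assumes sets [measurable_cong, simp]: "sets P = sets borel" "sets Q = sets borel"
    and pos: "0 \<le> c" "0 < \<kappa>" "0 \<le> \<theta>" "\<theta> < 1"
    and Q_le: "\<And>B. B \<in> sets borel \<Longrightarrow> emeasure Q B \<le> ennreal c * emeasure lborel B"
    and A [measurable]: "A \<in> sets borel"
    and QP: "\<And>B. B \<in> sets borel \<Longrightarrow> B \<subseteq> A \<Longrightarrow> emeasure Q B \<le> ennreal \<theta> * emeasure P B"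
    and "E \<subseteq> A"
    and small: "\<And>x d. x \<in> E \<Longrightarrow> 0 < d \<Longrightarrow> \<exists>u v. u < v \<and> x \<in> {u..v} \<and> v - u < d \<and>
      emeasure P {u..v} \<le> emeasure Q {u..v} \<and> ennreal (\<kappa> * (v - u)) \<le> emeasure Q {u..v}"
  shows "negligible E"
proof (subst negligible_on_intervals, intro allI, subst negligible_outer_le, intro allI impI)
  fix a b e :: real assume "0 < e"
  define A' where "A' = A \<inter> {a..b}"
  have [measurable]: "A' \<in> sets borel" by (simp add: A'_def)
  \<comment> \<open>Chosen so that \<open>c \<epsilon> / (\<kappa> (1 - \<theta>)) \<le> e\<close>; the summand 1 allows \<open>c = 0\<close>.\<close>
  define \<epsilon> where "\<epsilon> = \<kappa> * (1 - \<theta>) * e / (c + 1)"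
  have "0 < \<epsilon>" using pos \<open>0 < e\<close> by (simp add: \<epsilon>_def)
  have "c * \<epsilon> = \<kappa> * (1 - \<theta>) * e * (c / (c + 1))" by (simp add: \<epsilon>_def)
  also have "\<dots> \<le> \<kappa> * (1 - \<theta>) * e * 1"
    using pos \<open>0 < e\<close> by (intro mult_left_mono) auto
  finally have \<epsilon>: "c * \<epsilon> \<le> \<kappa> * (1 - \<theta>) * e" by simp
  obtain U0 where U0: "open U0" "A' \<subseteq> U0" "emeasure lborel (U0 - A') < \<epsilon>"
    using outer_regular_lborel[of A' \<epsilon>] \<open>0 < \<epsilon>\<close> by auto
  \<comment> \<open>The bounded factor makes the measure of the cover finite, so that \<open>\<theta> Q V\<close> can be subtracted.\<close>
  define U where "U = U0 \<inter> {a - 1<..<b + 1}"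
  have "open U" using U0 by (auto simp: U_def)
  have "E \<inter> {a..b} \<subseteq> U" using U0 \<open>E \<subseteq> A\<close> by (auto simp: U_def A'_def)
  define K where "K = {(m, r). 0 < r \<and> cball m r \<subseteq> U \<and> emeasure P (cball m r) \<le> emeasure Q (cball m r)
    \<and> ennreal (\<kappa> * (2 * r)) \<le> emeasure Q (cball m r)}"
  have fine: "\<exists>i. i \<in> K \<and> x \<in> cball (fst i) (snd i) \<and> snd i < d" if x: "x \<in> E \<inter> {a..b}" and "0 < d" for x d
  proof -
    obtain \<delta> where \<delta>: "0 < \<delta>" "ball x \<delta> \<subseteq> U"
      using \<open>open U\<close> \<open>E \<inter> {a..b} \<subseteq> U\<close> x by (meson openE subsetD)
    obtain u v where uv: "u < v" "x \<in> {u..v}" "v - u < min d \<delta>"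
      "emeasure P {u..v} \<le> emeasure Q {u..v}" "ennreal (\<kappa> * (v - u)) \<le> emeasure Q {u..v}"
      using small[of x "min d \<delta>"] x \<delta> \<open>0 < d\<close> by auto
    have cb: "cball ((u + v) / 2) ((v - u) / 2) = {u..v}"
      by (simp add: cball_eq_atLeastAtMost field_simps)
    have dbl: "2 * ((v - u) / 2) = v - u" by simp
    have "{u..v} \<subseteq> ball x \<delta>" using uv by (auto simp: dist_real_def)
    then have "((u + v) / 2, (v - u) / 2) \<in> K"
      using uv \<delta> by (auto simp: K_def cb dbl simp del: cball_eq_atLeastAtMost times_divide_eq_right)
    then show ?thesis
      using uv by (intro exI[of _ "((u + v) / 2, (v - u) / 2)"]) (simp add: cb del: cball_eq_atLeastAtMost)
  qed
  have K_pos: "0 < snd i" if "i \<in> K" for i using that by (auto simp: K_def)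
  obtain C where C: "countable C" "C \<subseteq> K"
    "pairwise (\<lambda>i j. disjnt (cball (fst i) (snd i)) (cball (fst j) (snd j))) C"
    "negligible (E \<inter> {a..b} - (\<Union>i\<in>C. cball (fst i) (snd i)))"
    by (rule Vitali_covering_theorem_cballs[OF K_pos fine])
  define V where "V = (\<Union>i\<in>C. cball (fst i) (snd i))"
  have "V \<subseteq> U" using C(2) unfolding V_def K_def by fastforce
  have V [measurable]: "V \<in> sets borel"
    unfolding V_def using C(1) by (intro sets.countable_UN') auto
  have disj: "disjoint_family_on (\<lambda>i. cball (fst i) (snd i)) C"
    using C(3) by (auto simp: disjoint_family_on_def pairwise_def disjnt_def)
  have sum: "emeasure M V = (\<integral>\<^sup>+i. emeasure M (cball (fst i) (snd i)) \<partial>count_space C)"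
    if "sets M = sets borel" for M
    unfolding V_def using C(1) that by (intro emeasure_UN_countable disj) auto
  have PQ: "emeasure P V \<le> emeasure Q V"
    using C(2) by (auto simp: sum K_def intro!: nn_integral_mono)
  have "ennreal \<kappa> * emeasure lborel V = (\<integral>\<^sup>+i. ennreal \<kappa> * emeasure lborel (cball (fst i) (snd i)) \<partial>count_space C)"
    by (simp add: sum nn_integral_cmult)
  also have "\<dots> \<le> emeasure Q V"
    unfolding sum[OF sets(2)]
  proof (rule nn_integral_mono)
    fix i assume "i \<in> space (count_space C)"
    then have i: "0 < snd i" "ennreal (\<kappa> * (2 * snd i)) \<le> emeasure Q (cball (fst i) (snd i))"
      using C(2) by (auto simp: K_def)
    have "ennreal \<kappa> * emeasure lborel (cball (fst i) (snd i)) = ennreal (\<kappa> * (2 * snd i))"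
      using i pos by (simp add: cball_eq_atLeastAtMost ennreal_mult)
    with i show "ennreal \<kappa> * emeasure lborel (cball (fst i) (snd i)) \<le> emeasure Q (cball (fst i) (snd i))"
      by simp
  qed
  finally have \<kappa>V: "ennreal \<kappa> * emeasure lborel V \<le> emeasure Q V" .
  have "emeasure lborel V \<le> emeasure lborel {a - 1..b + 1}"
    using \<open>V \<subseteq> U\<close> by (intro emeasure_mono) (auto simp: U_def)
  also have "\<dots> < \<infinity>" by (simp add: emeasure_lborel_Icc_eq)
  finally have fin: "emeasure lborel V < \<infinity>" .
  have "emeasure Q V \<le> ennreal c * emeasure lborel V" by (rule Q_le) simp
  also have "\<dots> < \<infinity>" using fin by (simp add: ennreal_mult_less_top)
  finally have Qfin: "emeasure Q V < \<infinity>" .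
  have "emeasure Q V = emeasure Q (V \<inter> A') + emeasure Q (V - A')"
    by (subst plus_emeasure) (auto intro: arg_cong[where f = "emeasure Q"])
  also have "\<dots> \<le> ennreal \<theta> * emeasure P (V \<inter> A') + ennreal c * emeasure lborel (V - A')"
    by (intro add_mono QP Q_le) (auto simp: A'_def)
  also have "\<dots> \<le> ennreal \<theta> * emeasure Q V + ennreal c * ennreal \<epsilon>"
  proof (intro add_mono mult_left_mono)
    show "emeasure P (V \<inter> A') \<le> emeasure Q V"
      using PQ by (rule order_trans[rotated]) (auto intro: emeasure_mono)
    have "emeasure lborel (V - A') \<le> emeasure lborel (U0 - A')"
      using \<open>V \<subseteq> U\<close> U0 by (intro emeasure_mono) (auto simp: U_def)
    with U0 show "emeasure lborel (V - A') \<le> ennreal \<epsilon>" by simp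
  qed auto
  finally have main: "emeasure Q V \<le> ennreal \<theta> * emeasure Q V + ennreal c * ennreal \<epsilon>" .
  obtain q where q: "0 \<le> q" "emeasure Q V = ennreal q"
    using Qfin by (auto elim: ennreal_cases)
  obtain v where v: "0 \<le> v" "emeasure lborel V = ennreal v"
    using fin by (auto elim: ennreal_cases)
  have "q \<le> \<theta> * q + c * \<epsilon>"
    using main pos q \<open>0 < \<epsilon>\<close> by (simp flip: ennreal_mult ennreal_plus add: ennreal_le_iff)
  moreover have "\<kappa> * v \<le> q"
    using \<kappa>V pos q v by (simp flip: ennreal_mult add: ennreal_le_iff)
  then have "(1 - \<theta>) * (\<kappa> * v) \<le> (1 - \<theta>) * q"
    using pos by (intro mult_left_mono) auto
  ultimately have "\<kappa> * (1 - \<theta>) * v \<le> \<kappa> * (1 - \<theta>) * e"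
    using \<epsilon> by (simp add: algebra_simps)
  then have "v \<le> e" using pos by (simp add: mult_le_cancel_left)
  let ?T = "V \<union> (E \<inter> {a..b} - V)"
  have neg: "negligible (E \<inter> {a..b} - V)"
    using C(4) by (simp add: V_def)
  have lm: "V \<in> lmeasurable" "E \<inter> {a..b} - V \<in> lmeasurable"
    using fin negligible_imp_measurable[OF neg] by (auto simp: fmeasurable_def)
  have "measure lebesgue ?T \<le> measure lebesgue V + measure lebesgue (E \<inter> {a..b} - V)"
    by (intro measure_Un_le fmeasurableD lm)
  moreover have "measure lebesgue (E \<inter> {a..b} - V) = 0"
    using neg by (rule negligible_imp_measure0)
  moreover have "measure lebesgue V = v" using v by (simp add: measure_def)
  ultimately have "measure lebesgue ?T \<le> e" using \<open>v \<le> e\<close> by simp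
  moreover have "?T \<in> lmeasurable" by (intro fmeasurable.Un lm)
  ultimately show "\<exists>T. E \<inter> cbox a b \<subseteq> T \<and> T \<in> lmeasurable \<and> measure lebesgue T \<le> e"
    by (intro exI[of _ ?T]) auto
qed

section \<open>Differentiability of Lipschitz functions almost everywhere\<close>

text \<open>
  The derivative is the Radon-Nikodym density \<open>f\<close> of the Stieltjes measure. The sets \<open>hi r s\<close> and
  \<open>lo r s\<close> collect the points where \<open>f\<close> and the difference quotients are separated by \<open>r < s\<close>.
  Outside their union over the positive rationals every positive rational bound on \<open>f x\<close> is
  eventually a bound on the quotients at \<open>x\<close>, up to an arbitrarily small loss.
\<close>

lemma mono_lipschitz_differentiable_negligible:
  fixes F :: "real \<Rightarrow> real"
  assumes mono: "\<And>x y. x \<le> y \<Longrightarrow> F x \<le> F y"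
    and lip: "\<And>x y. x \<le> y \<Longrightarrow> F y - F x \<le> c * (y - x)"
  shows "negligible {x. \<nexists>D. (F has_real_derivative D) (at x)}"
proof -
  have "0 \<le> c" using mono[of 0 1] lip[of 0 1] by simp
  have "c-lipschitz_on UNIV F"
  proof (rule lipschitz_onI)
    show "dist (F x) (F y) \<le> c * dist x y" for x y
      using mono[of x y] mono[of y x] lip[of x y] lip[of y x] by (cases x y rule: linorder_le_cases) (auto simp: dist_real_def)
  qed fact
  then have contF: "continuous_on UNIV F" by (rule lipschitz_on_continuous_on)
  define M where "M = interval_measure F"
  have [measurable_cong, simp]: "sets M = sets borel" by (simp add: M_def)
  have M_Icc: "emeasure M {u..v} = ennreal (F v - F u)" if "u \<le> v" for u v
    unfolding M_def using that mono contF by (rule emeasure_interval_measure_Icc)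
  have M_le: "emeasure M B \<le> ennreal c * emeasure lborel B" if "B \<in> sets borel" for B
    using \<open>0 \<le> c\<close> that
    by (intro emeasure_le_lborel_if_le_on_intervals) (auto simp: M_Icc lip intro: ennreal_leI)
  have "absolutely_continuous lborel M"
    unfolding absolutely_continuous_def
  proof
    fix B assume "B \<in> null_sets (lborel :: real measure)"
    then have "B \<in> sets borel" "emeasure lborel B = 0" by auto
    then show "B \<in> null_sets M" using M_le[of B] by auto
  qed
  then obtain f where f [measurable]: "f \<in> borel_measurable borel" and M_f: "density lborel f = M"
    using sigma_finite_measure.Radon_Nikodym[OF sigma_finite_lborel, of M] by auto
  have M_eq: "emeasure M B = (\<integral>\<^sup>+x. f x * indicator B x \<partial>lborel)" if "B \<in> sets borel" for B
    using that unfolding M_f[symmetric] by (simp add: emeasure_density)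
  define hi where "hi r s = {x. f x \<le> ennreal r \<and>
    (\<forall>d>0. \<exists>u v. u < v \<and> x \<in> {u..v} \<and> v - u < d \<and> s * (v - u) \<le> F v - F u)}" for r s
  define lo where "lo r s = {x. ennreal s \<le> f x \<and>
    (\<forall>d>0. \<exists>u v. u < v \<and> x \<in> {u..v} \<and> v - u < d \<and> F v - F u \<le> r * (v - u))}" for r s
  have const: "emeasure (density lborel (\<lambda>_. ennreal t)) B = ennreal t * emeasure lborel B"
    if "B \<in> sets borel" for t and B :: "real set"
    using that by (simp add: emeasure_density_const)
  have hi: "negligible (hi r s)" if "0 < r" "r < s" for r s
  proof (rule negligible_if_measures_compare_on_small_intervals
      [where P = "density lborel (\<lambda>_. ennreal s)" and Q = M and A = "{x. f x \<le> ennreal r}"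
        and c = c and \<kappa> = s and \<theta> = "r / s"])
    fix B assume B: "B \<in> sets borel" "B \<subseteq> {x. f x \<le> ennreal r}"
    have r: "ennreal r = ennreal (r / s) * ennreal s"
      using that by (simp flip: ennreal_mult)
    have "emeasure M B \<le> (\<integral>\<^sup>+x. ennreal r * indicator B x \<partial>lborel)"
      using B by (auto simp: M_eq intro!: nn_integral_mono split: split_indicator)
    also have "\<dots> = ennreal r * emeasure lborel B"
      using B by (simp add: nn_integral_cmult_indicator)
    also have "\<dots> = ennreal (r / s) * emeasure (density lborel (\<lambda>_. ennreal s)) B"
      using B by (simp only: const r mult.assoc)
    finally show "emeasure M B \<le> ennreal (r / s) * emeasure (density lborel (\<lambda>_. ennreal s)) B" .
  next
    fix x d :: real assume "x \<in> hi r s" "0 < d"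
    then obtain u v where "u < v" "x \<in> {u..v}" "v - u < d" "s * (v - u) \<le> F v - F u"
      unfolding hi_def by blast
    then show "\<exists>u v. u < v \<and> x \<in> {u..v} \<and> v - u < d \<and>
        emeasure (density lborel (\<lambda>_. ennreal s)) {u..v} \<le> emeasure M {u..v} \<and>
        ennreal (s * (v - u)) \<le> emeasure M {u..v}"
      using that by (intro exI[of _ u] exI[of _ v])
        (auto simp: const M_Icc simp flip: ennreal_mult intro: ennreal_leI)
  qed (use that \<open>0 \<le> c\<close> M_le in \<open>auto simp: hi_def\<close>)
  have lo: "negligible (lo r s)" if "0 < r" "r < s" for r s
  proof (rule negligible_if_measures_compare_on_small_intervals
      [where P = M and Q = "density lborel (\<lambda>_. ennreal r)" and A = "{x. ennreal s \<le> f x}"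
        and c = r and \<kappa> = r and \<theta> = "r / s"])
    fix B assume B: "B \<in> sets borel" "B \<subseteq> {x. ennreal s \<le> f x}"
    have r: "ennreal r = ennreal (r / s) * ennreal s"
      using that by (simp flip: ennreal_mult)
    have "emeasure (density lborel (\<lambda>_. ennreal r)) B = ennreal r * emeasure lborel B"
      using B by (simp add: const)
    also have "\<dots> = ennreal (r / s) * (\<integral>\<^sup>+x. ennreal s * indicator B x \<partial>lborel)"
      using B by (simp only: nn_integral_cmult_indicator sets_lborel r mult.assoc)
    also have "\<dots> \<le> ennreal (r / s) * emeasure M B"
      using B by (auto simp: M_eq intro!: nn_integral_mono mult_left_mono split: split_indicator)
    finally show "emeasure (density lborel (\<lambda>_. ennreal r)) B \<le> ennreal (r / s) * emeasure M B" .
  next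
    fix x d :: real assume "x \<in> lo r s" "0 < d"
    then obtain u v where "u < v" "x \<in> {u..v}" "v - u < d" "F v - F u \<le> r * (v - u)"
      unfolding lo_def by blast
    then show "\<exists>u v. u < v \<and> x \<in> {u..v} \<and> v - u < d \<and>
        emeasure M {u..v} \<le> emeasure (density lborel (\<lambda>_. ennreal r)) {u..v} \<and>
        ennreal (r * (v - u)) \<le> emeasure (density lborel (\<lambda>_. ennreal r)) {u..v}"
      using that by (intro exI[of _ u] exI[of _ v])
        (auto simp: const M_Icc simp flip: ennreal_mult intro: ennreal_leI)
  qed (use that in \<open>auto simp: lo_def const\<close>)
  \<comment> \<open>Only \<open>r > 0\<close> is covered, since the quotients of a monotone function are nonnegative anyway.\<close>
  define I where "I = {(r, s). r \<in> \<rat> \<and> s \<in> \<rat> \<and> 0 < r \<and> r < (s::real)}"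
  define N where "N = (\<Union>(r, s)\<in>I. hi r s \<union> lo r s)"
  have "countable I"
    by (rule countable_subset[of _ "\<rat> \<times> \<rat>"]) (auto simp: I_def countable_rat)
  then have "negligible N"
    unfolding N_def by (intro negligible_countable_Union countable_image)
      (auto simp: I_def intro: hi lo negligible_Un)
  moreover have "{x. \<nexists>D. (F has_real_derivative D) (at x)} \<subseteq> N"
  proof (rule subsetI, rule ccontr)
    fix x assume nodiff: "x \<in> {x. \<nexists>D. (F has_real_derivative D) (at x)}" and "x \<notin> N"
    define q where "q y = (F y - F x) / (y - x)" for y
    have q_bounds: "0 \<le> q y" "q y \<le> c" if "y \<noteq> x" for y
      using that mono[of x y] mono[of y x] lip[of x y] lip[of y x]
      by (cases x y rule: linorder_cases; force simp: q_def field_simps)+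
    have upper: "\<forall>\<^sub>F y in at x. q y < s"
      if rs: "r \<in> \<rat>" "s \<in> \<rat>" "0 < r" "r < s" and fx: "f x \<le> ennreal r" for r s
    proof -
      have "x \<notin> hi r s" using \<open>x \<notin> N\<close> rs by (auto simp: N_def I_def)
      then obtain d where "0 < d"
        and "\<not> (\<exists>u v. u < v \<and> x \<in> {u..v} \<and> v - u < d \<and> s * (v - u) \<le> F v - F u)"
        using fx unfolding hi_def by blast
      then have d: "F v - F u < s * (v - u)" if "u < v" "x \<in> {u..v}" "v - u < d" for u v
        using that by (meson not_le)
      have "q y < s" if "y \<noteq> x" "dist y x < d" for y
        using d[of x y] d[of y x] that
        by (cases x y rule: linorder_cases) (auto simp: q_def dist_real_def field_simps)
      then show ?thesis using \<open>0 < d\<close> by (auto simp: eventually_at)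
    qed
    have lower: "\<forall>\<^sub>F y in at x. r < q y"
      if rs: "r \<in> \<rat>" "s \<in> \<rat>" "0 < r" "r < s" and fx: "ennreal s \<le> f x" for r s
    proof -
      have "x \<notin> lo r s" using \<open>x \<notin> N\<close> rs by (auto simp: N_def I_def)
      then obtain d where "0 < d"
        and "\<not> (\<exists>u v. u < v \<and> x \<in> {u..v} \<and> v - u < d \<and> F v - F u \<le> r * (v - u))"
        using fx unfolding lo_def by blast
      then have d: "r * (v - u) < F v - F u" if "u < v" "x \<in> {u..v}" "v - u < d" for u v
        using that by (meson not_le)
      have "r < q y" if "y \<noteq> x" "dist y x < d" for y
        using d[of x y] d[of y x] that
        by (cases x y rule: linorder_cases) (auto simp: q_def dist_real_def field_simps)
      then show ?thesis using \<open>0 < d\<close> by (auto simp: eventually_at)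
    qed
    \<comment> \<open>An infinite density would push the quotients beyond the Lipschitz constant \<open>c\<close>.\<close>
    have "f x \<noteq> \<infinity>"
    proof
      assume "f x = \<infinity>"
      obtain r where r: "r \<in> \<rat>" "c < r" using Rats_dense_in_real[of c "c + 1"] by auto
      obtain s where s: "s \<in> \<rat>" "r < s" using Rats_dense_in_real[of r "r + 1"] by auto
      have "\<forall>\<^sub>F y in at x. r < q y"
        using lower[of r s] r s \<open>0 \<le> c\<close> \<open>f x = \<infinity>\<close> by simp
      moreover have "\<forall>\<^sub>F y in at x. q y \<le> c"
        by (auto simp: eventually_at_filter q_bounds)
      ultimately have "\<forall>\<^sub>F y in at x. False"
        by eventually_elim (use r in auto)
      then show False by simp
    qed
    then obtain l where l: "0 \<le> l" "f x = ennreal l" by (auto elim: ennreal_cases)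
    have "(q \<longlongrightarrow> l) (at x)"
    proof (rule order_tendstoI)
      fix a assume "l < a"
      obtain r where r: "r \<in> \<rat>" "l < r" "r < a" using Rats_dense_in_real[OF \<open>l < a\<close>] by auto
      obtain s where s: "s \<in> \<rat>" "r < s" "s < a" using Rats_dense_in_real[OF \<open>r < a\<close>] by auto
      have "\<forall>\<^sub>F y in at x. q y < s"
        using upper[of r s] r s l by (simp add: ennreal_leI)
      then show "\<forall>\<^sub>F y in at x. q y < a" by eventually_elim (use s in auto)
    next
      fix a assume "a < l"
      show "\<forall>\<^sub>F y in at x. a < q y"
      proof (cases "a < 0")
        case True
        have "\<forall>\<^sub>F y in at x. 0 \<le> q y"
          by (auto simp: eventually_at_filter q_bounds)
        then show ?thesis by eventually_elim (use True in auto)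
      next
        case False
        obtain s where s: "s \<in> \<rat>" "a < s" "s < l" using Rats_dense_in_real[OF \<open>a < l\<close>] by auto
        obtain r where r: "r \<in> \<rat>" "a < r" "r < s" using Rats_dense_in_real[OF \<open>a < s\<close>] by auto
        have "\<forall>\<^sub>F y in at x. r < q y"
          using lower[of r s] r s l False by (simp add: ennreal_leI)
        then show ?thesis by eventually_elim (use r in auto)
      qed
    qed
    then have "(F has_real_derivative l) (at x)"
      by (simp add: has_field_derivative_iff q_def[abs_def])
    then show False using nodiff by blast
  qed
  ultimately show ?thesis by (rule negligible_subset)
qed

text \<open>
  Extended constantly beyond the interval, \<open>g\<close> becomes \<open>L\<close>-Lipschitz on the line, and adding
  \<open>L x\<close> makes it nondecreasing with Lipschitz constant \<open>2 L\<close>.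
\<close>

lemma lipschitz_on_Icc_differentiable_negligible:
  fixes g :: "real \<Rightarrow> real"
  assumes "a \<le> b" and lip: "L-lipschitz_on {a..b} g"
  shows "negligible {x \<in> {a..b}. \<not> g differentiable (at x within {a..b})}"
proof -
  define k where "k x = min b (max a x)" for x
  define F where "F x = g (k x) + L * x" for x
  have "0 \<le> L" using lip by (rule lipschitz_on_nonneg)
  have gk: "\<bar>g (k y) - g (k x)\<bar> \<le> L * (y - x)" if "x \<le> y" for x y
  proof -
    have "\<bar>g (k y) - g (k x)\<bar> \<le> L * \<bar>k y - k x\<bar>"
      using lipschitz_onD[OF lip, of "k y" "k x"] \<open>a \<le> b\<close> by (auto simp: k_def dist_real_def)
    also have "\<dots> \<le> L * (y - x)"
      using that \<open>0 \<le> L\<close> \<open>a \<le> b\<close> by (intro mult_left_mono) (auto simp: k_def)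
    finally show ?thesis .
  qed
  have "negligible {x. \<nexists>D. (F has_real_derivative D) (at x)}"
  proof (rule mono_lipschitz_differentiable_negligible[where c = "2 * L"])
    fix x y :: real assume "x \<le> y"
    from gk[OF this] show "F x \<le> F y" "F y - F x \<le> 2 * L * (y - x)"
      by (auto simp: F_def algebra_simps abs_le_iff)
  qed
  moreover have "{x \<in> {a..b}. \<not> g differentiable (at x within {a..b})} \<subseteq> {x. \<nexists>D. (F has_real_derivative D) (at x)}"
  proof safe
    fix x D assume x: "x \<in> {a..b}" and "(F has_real_derivative D) (at x)"
      and nd: "\<not> g differentiable (at x within {a..b})"
    then have "((\<lambda>x. F x - L * x) has_real_derivative D - L) (at x within {a..b})"
      by (auto intro!: derivative_eq_intros intro: has_field_derivative_at_within)
    then have "(g has_real_derivative D - L) (at x within {a..b})"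
      by (rule has_field_derivative_transform_within[OF _ zero_less_one x]) (auto simp: F_def k_def)
    with nd show False
      by (auto simp: has_field_derivative_def differentiable_def)
  qed
  ultimately show ?thesis by (rule negligible_subset)
qed

lemma lipschitz_on_Icc_euclidean_differentiable_negligible:
  fixes g :: "real \<Rightarrow> 'a::euclidean_space"
  assumes "a \<le> b" and lip: "L-lipschitz_on {a..b} g"
  shows "negligible {x \<in> {a..b}. \<not> g differentiable (at x within {a..b})}"
proof -
  have "L-lipschitz_on {a..b} (\<lambda>x. g x \<bullet> i)" if "i \<in> Basis" for i
  proof (rule lipschitz_onI)
    fix x y assume "x \<in> {a..b}" "y \<in> {a..b}"
    then have "dist (g x) (g y) \<le> L * dist x y" by (rule lipschitz_onD[OF lip])
    moreover have "dist (g x \<bullet> i) (g y \<bullet> i) \<le> dist (g x) (g y)"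
      using Basis_le_norm[OF that, of "g x - g y"] by (simp add: dist_norm inner_diff_left)
    ultimately show "dist (g x \<bullet> i) (g y \<bullet> i) \<le> L * dist x y" by simp
  qed (rule lipschitz_on_nonneg[OF lip])
  then have "negligible (\<Union>i\<in>Basis. {x \<in> {a..b}. \<not> (\<lambda>x. g x \<bullet> i) differentiable (at x within {a..b})})"
    using lipschitz_on_Icc_differentiable_negligible[OF \<open>a \<le> b\<close>]
    by (intro negligible_Union) (auto simp only: finite_Basis finite_imageI)
  then show ?thesis
    by (rule negligible_subset) (auto simp: differentiable_componentwise_within[of g])
qed

lemma lipschitz_on_abs_derivative_le:
  fixes g :: "real \<Rightarrow> real"
  assumes "a < b" and lip: "L-lipschitz_on {a..b} g" and x: "x \<in> {a..b}"
    and deriv: "(g has_real_derivative D) (at x within {a..b})"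
  shows "\<bar>D\<bar> \<le> L"
proof (rule tendsto_upperbound)
  show "((\<lambda>y. \<bar>(g y - g x) / (y - x)\<bar>) \<longlongrightarrow> \<bar>D\<bar>) (at x within {a..b})"
    using deriv by (intro tendsto_rabs) (simp add: has_field_derivative_iff)
  show "\<forall>\<^sub>F y in at x within {a..b}. \<bar>(g y - g x) / (y - x)\<bar> \<le> L"
    unfolding eventually_at_filter
  proof (intro always_eventually allI impI)
    fix y assume "y \<noteq> x" "y \<in> {a..b}"
    then show "\<bar>(g y - g x) / (y - x)\<bar> \<le> L"
      using lipschitz_onD[OF lip _ x, of y] by (simp add: dist_real_def abs_divide pos_divide_le_eq)
  qed
  show "at x within {a..b} \<noteq> bot"
    using x \<open>a < b\<close> by (simp add: trivial_limit_within islimpt_Icc)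
qed

section \<open>The fundamental theorem of calculus for Lipschitz functions\<close>

text \<open>
  The gauge is the intersection of the one that expresses differentiability off \<open>N\<close> with one for
  which the Riemann sums of the indicator of \<open>N\<close> are small. An interval tagged in \<open>N\<close>
  contributes at most \<open>L\<close> times its length, hence at most \<open>L\<close> times its term in the latter
  sum.
\<close>

lemma lipschitz_on_has_integral_derivative:
  fixes g :: "real \<Rightarrow> 'a::banach"
  assumes "a \<le> b" and lip: "L-lipschitz_on {a..b} g" and N: "negligible N"
    and deriv: "\<And>x. x \<in> {a..b} - N \<Longrightarrow> (g has_vector_derivative g' x) (at x within {a..b})"
  shows "(g' has_integral (g b - g a)) {a..b}"
proof -
  \<comment> \<open>The values of \<open>g'\<close> on \<open>N\<close> are arbitrary; zero removes them from the Riemann sums.\<close>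
  define h where "h x = (if x \<in> N then 0 else g' x)" for x
  have "(h has_integral (g b - g a)) {a..b}"
    unfolding has_integral_factor_content_real
  proof (intro allI impI)
    fix e :: real assume "0 < e"
    have "0 \<le> L" using lip by (rule lipschitz_on_nonneg)
    have "\<exists>d>0. x \<in> {a..b} - N \<longrightarrow>
         (\<forall>y\<in>{a..b}. norm (y-x) < d \<longrightarrow> norm (g y - g x - (y-x) *\<^sub>R g' x) \<le> e/2 * norm (y-x))" for x
      using deriv[unfolded has_vector_derivative_def has_derivative_within_alt, of x] \<open>0 < e\<close>
      by (meson half_gt_zero zero_less_one)
    then obtain d where d: "\<And>x. 0 < d x"
      "\<And>x y. \<lbrakk>x \<in> {a..b} - N; y \<in> {a..b}; norm (y-x) < d x\<rbrakk>
        \<Longrightarrow> norm (g y - g x - (y-x) *\<^sub>R g' x) \<le> e/2 * norm (y-x)"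
      by metis
    have "(indicat_real N has_integral 0) {a..b}"
      using N unfolding negligible_def cbox_interval[symmetric] by blast
    note N_integral = has_integral_factor_content_real[THEN iffD1, rule_format, OF this]
    have "0 < e / (2 * (L + 1))" using \<open>0 < e\<close> \<open>0 \<le> L\<close> by simp
    from N_integral[OF this] obtain \<gamma> where \<gamma>: "gauge \<gamma>" and small: "\<And>p. p tagged_division_of {a..b} \<Longrightarrow> \<gamma> fine p \<Longrightarrow>
        norm ((\<Sum>(x,K)\<in>p. measure lborel K *\<^sub>R indicat_real N x) - 0) \<le> e / (2 * (L + 1)) * measure lborel {a..b}"
      by metis
    show "\<exists>d. gauge d \<and> (\<forall>p. p tagged_division_of {a..b} \<and> d fine p \<longrightarrow>
      norm ((\<Sum>(x, K)\<in>p. measure lborel K *\<^sub>R h x) - (g b - g a)) \<le> e * measure lborel {a..b})"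
    proof (intro exI conjI allI impI)
      show "gauge (\<lambda>x. ball x (d x) \<inter> \<gamma> x)"
        using d(1) \<gamma> by (intro gauge_Int gauge_ball_dependent) auto
    next
      fix p assume "p tagged_division_of {a..b} \<and> (\<lambda>x. ball x (d x) \<inter> \<gamma> x) fine p"
      then have p: "p tagged_division_of {a..b}" and
        fine: "(\<lambda>x. ball x (d x)) fine p" "\<gamma> fine p" by (auto simp: fine_Int)
      have ba: "b - a = (\<Sum>(x,K)\<in>p. Sup K - Inf K)" "g b - g a = (\<Sum>(x,K)\<in>p. g (Sup K) - g (Inf K))"
        using additive_tagged_division_1[OF \<open>a \<le> b\<close> p, of "\<lambda>x. x"]
          additive_tagged_division_1[OF \<open>a \<le> b\<close> p, of g] by auto
      have step: "norm (measure lborel K *\<^sub>R h x - (g (Sup K) - g (Inf K)))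
          \<le> e/2 * (Sup K - Inf K) + L * (measure lborel K * indicat_real N x)" if xK: "(x, K) \<in> p" for x K
      proof -
        obtain u v where K: "K = {u..v}" "x \<in> K" "K \<subseteq> {a..b}"
          using tagged_division_ofD(2-4)[OF p xK] by (auto simp: cbox_interval)
        then have "u \<le> v" by auto
        have uv: "u \<in> {a..b}" "v \<in> {a..b}" "x \<in> {a..b}" "u \<in> K" "v \<in> K" using K \<open>u \<le> v\<close> by auto
        have SI: "Sup K = v" "Inf K = u" "measure lborel K = v - u" using K \<open>u \<le> v\<close> by auto
        show ?thesis
        proof (cases "x \<in> N")
          case True
          have "norm (g v - g u) \<le> L * (v - u)"
            using lipschitz_onD[OF lip uv(2,1)] \<open>u \<le> v\<close> by (simp add: dist_norm)
          moreover have "0 \<le> e/2 * (v - u)" using \<open>0 < e\<close> \<open>u \<le> v\<close> by simp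
          ultimately show ?thesis using True by (simp add: SI h_def norm_minus_commute)
        next
          case False
          have "K \<subseteq> ball x (d x)" using fine(1) that by blast
          then have du: "norm (u - x) < d x" "norm (v - x) < d x"
            using uv by (auto simp: dist_norm norm_minus_commute subset_iff)
          have "(v - u) *\<^sub>R g' x - (g v - g u) =
              (g u - g x - (u - x) *\<^sub>R g' x) - (g v - g x - (v - x) *\<^sub>R g' x)"
            by (auto simp: algebra_simps)
          then have "norm ((v - u) *\<^sub>R g' x - (g v - g u))
              \<le> norm (g u - g x - (u - x) *\<^sub>R g' x) + norm (g v - g x - (v - x) *\<^sub>R g' x)"
            by (simp only: norm_triangle_ineq4)
          also have "\<dots> \<le> e/2 * norm (u - x) + e/2 * norm (v - x)"
            using False uv du by (intro add_mono d) auto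
          also have "\<dots> = e/2 * (v - u)"
            using K by (auto simp: field_simps)
          finally show ?thesis using False by (simp add: SI h_def)
        qed
      qed
      have "norm ((\<Sum>(x, K)\<in>p. measure lborel K *\<^sub>R h x) - (g b - g a))
        = norm (\<Sum>(x, K)\<in>p. measure lborel K *\<^sub>R h x - (g (Sup K) - g (Inf K)))"
        unfolding ba by (simp add: sum_subtractf split_def)
      also have "\<dots> \<le> (\<Sum>(x, K)\<in>p. e/2 * (Sup K - Inf K) + L * (measure lborel K * indicat_real N x))"
        using step by (intro sum_norm_le) auto
      also have "\<dots> = e/2 * (b - a) + L * (\<Sum>(x, K)\<in>p. measure lborel K *\<^sub>R indicat_real N x)"
        unfolding ba by (simp add: sum.distrib split_def sum_distrib_left)
      also have "\<dots> \<le> e/2 * (b - a) + L * (e / (2 * (L + 1)) * measure lborel {a..b})"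
        using small[OF p fine(2)] \<open>0 \<le> L\<close> by (intro add_left_mono mult_left_mono) auto
      also have "\<dots> \<le> e * measure lborel {a..b}"
      proof -
        have "L * (e / (2 * (L + 1))) \<le> e/2" using \<open>0 \<le> L\<close> \<open>0 < e\<close> by (simp add: field_simps)
        then have "L * (e / (2 * (L + 1))) * (b - a) \<le> e/2 * (b - a)"
          using \<open>a \<le> b\<close> by (intro mult_right_mono) auto
        then have "e/2 * (b - a) + L * (e / (2 * (L + 1))) * (b - a) \<le> e/2 * (b - a) + e/2 * (b - a)"
          by (rule add_left_mono)
        also have "\<dots> = e * (b - a)"
          by (simp flip: distrib_right)
        finally have "e/2 * (b - a) + L * (e / (2 * (L + 1))) * (b - a) \<le> e * (b - a)" .
        then show ?thesis using \<open>a \<le> b\<close> by (simp only: measure_lborel_Icc mult.assoc)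
      qed
      finally show "norm ((\<Sum>(x, K)\<in>p. measure lborel K *\<^sub>R h x) - (g b - g a)) \<le> e * measure lborel {a..b}" .
    qed
  qed
  then show ?thesis
    by (rule has_integral_spike[OF N, rotated]) (auto simp: h_def)
qed

section \<open>The Rankine-Hugoniot condition along Lipschitz paths\<close>

lemma locally_lipschitz_on_compact:
  assumes "compact S" and "locally_lipschitz_on S f"
  obtains L where "L-lipschitz_on S f"
proof -
  \<comment> \<open>\<open>local_lipschitz\<close> is about families of functions; here the family has one member,
    with the dummy index 0.\<close>
  have "local_lipschitz {0::real} S (\<lambda>_. f)"
    using assms(2) unfolding local_lipschitz_def locally_lipschitz_on_def by blast
  then show thesis
    using local_lipschitz_compact_implies_lipschitz[of "{0::real}" S "\<lambda>_. f"] assms(1) that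
    by auto
qed

text \<open>
  For fixed end states, the joint local Lipschitz condition restricts to the compact parameter
  interval, where it becomes a single Lipschitz constant.
\<close>

lemma dlm_path_lipschitz_on:
  assumes "dlm_path \<phi>"
  obtains L where "L-lipschitz_on {0..1} (\<lambda>t. \<phi> t vL vR)"
proof -
  have "\<exists>e>0. \<exists>L. L-lipschitz_on (cball t e \<inter> {0..1}) (\<lambda>t. \<phi> t vL vR)" if t: "t \<in> {0..1}" for t
  proof -
    have loc: "locally_lipschitz_on ({0..1} \<times> UNIV \<times> UNIV) (\<lambda>(t, vL, vR). \<phi> t vL vR)"
      using assms by (simp add: dlm_path_def)
    obtain e L where "0 < e" and
      L: "L-lipschitz_on (cball (t, vL, vR) e \<inter> {0..1} \<times> UNIV \<times> UNIV) (\<lambda>(t, vL, vR). \<phi> t vL vR)"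
      using bspec[OF loc[unfolded locally_lipschitz_on_def], of "(t, vL, vR)"] t by auto
    have "L-lipschitz_on (cball t e \<inter> {0..1}) (\<lambda>t. \<phi> t vL vR)"
    proof (rule lipschitz_onI)
      fix r r' assume "r \<in> cball t e \<inter> {0..1}" "r' \<in> cball t e \<inter> {0..1}"
      then show "dist (\<phi> r vL vR) (\<phi> r' vL vR) \<le> L * dist r r'"
        using lipschitz_onD[OF L, of "(r, vL, vR)" "(r', vL, vR)"] by (simp add: dist_Pair_Pair)
    qed (rule lipschitz_on_nonneg[OF L])
    with \<open>0 < e\<close> show ?thesis by blast
  qed
  then have "locally_lipschitz_on {0..1} (\<lambda>t. \<phi> t vL vR)"
    unfolding locally_lipschitz_on_def by blast
  from locally_lipschitz_on_compact[OF compact_Icc this] that show thesis by blast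
qed

theorem theorem2p1:
  fixes uL \<sigma>L uR \<sigma>R s :: real
    and vL vR :: "real^2"
    and \<phi> :: "real \<Rightarrow> real^2 \<Rightarrow> real^2 \<Rightarrow> real^2"
  assumes vL: "vL = vector [uL, \<sigma>L]"
    and vR: "vR = vector [uR, \<sigma>R]"
    and neq: "uL \<noteq> uR"
    and path: "dlm_path \<phi>"
    and s: "s = ((uR^2 / 2 - uL^2 / 2) - (\<sigma>R - \<sigma>L)) / (uR - uL)"
    and cond: "integral {0..1} (\<lambda>t. \<phi> t vL vR $ 1 * path_deriv (\<lambda>r. \<phi> r vL vR $ 2) t)
             = (\<sigma>R - \<sigma>L) * (((uR^2 / 2 - uL^2 / 2) - (\<sigma>R - \<sigma>L)) / (uR - uL))"
  shows "((\<lambda>t. ((- s) *\<^sub>R mat 1 + coeff_matrix (\<phi> t vL vR)) *v path_deriv (\<lambda>r. \<phi> r vL vR) t)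
           has_integral 0) {0..1}"
proof -
  define x where "x t = \<phi> t vL vR" for t
  define p where "p = path_deriv x"
  define N where "N = {t \<in> {0..1}. \<not> x differentiable (at t within {0..1})}"
  obtain L where lip: "L-lipschitz_on {0..1} x"
    using dlm_path_lipschitz_on[OF path] unfolding x_def by blast
  have N: "negligible N"
    unfolding N_def by (rule lipschitz_on_Icc_euclidean_differentiable_negligible[OF _ lip]) simp
  have ends: "x 0 = vL" "x 1 = vR"
    using path by (auto simp: x_def dlm_path_def)
  have x': "(x has_vector_derivative p t) (at t within {0..1})" if "t \<in> {0..1} - N" for t
    using that by (simp add: N_def p_def path_deriv_def vector_derivative_works)
  have x'_nth: "((\<lambda>r. x r $ i) has_vector_derivative p t $ i) (at t within {0..1})"
    if "t \<in> {0..1} - N" for t i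
    by (rule bounded_linear.has_vector_derivative[OF bounded_linear_vec_nth x'[OF that]])
  have lip_nth: "L-lipschitz_on {0..1} (\<lambda>t. x t $ i)" for i
  proof (rule lipschitz_onI)
    fix t r :: real assume "t \<in> {0..1}" "r \<in> {0..1}"
    then have "dist (x t) (x r) \<le> L * dist t r" by (rule lipschitz_onD[OF lip])
    then show "dist (x t $ i) (x r $ i) \<le> L * dist t r"
      using dist_vec_nth_le[of "x t" i "x r"] by simp
  qed (rule lipschitz_on_nonneg[OF lip])
  have p_int: "((\<lambda>t. p t $ i) has_integral (vR $ i - vL $ i)) {0..1}" for i
    using lipschitz_on_has_integral_derivative[OF _ lip_nth N x'_nth, of i] by (simp add: ends)

  have x_cont: "continuous_on {0..1} (\<lambda>t. x t $ 1)"
    using lip_nth by (rule lipschitz_on_continuous_on)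
  then have x_bdd: "bounded ((\<lambda>t. x t $ 1) ` {0..1})"
    by (intro compact_imp_bounded compact_continuous_image) auto
  then obtain B where "0 < B" and B: "\<And>t. t \<in> {0..1} \<Longrightarrow> \<bar>x t $ 1\<bar> \<le> B"
    by (auto simp: bounded_pos)
  have "0 \<le> L" using lip by (rule lipschitz_on_nonneg)
  have "(B * L)-lipschitz_on {0..1} (\<lambda>t. (x t $ 1)\<^sup>2 / 2)"
  proof (rule lipschitz_onI)
    fix t r :: real assume tr: "t \<in> {0..1}" "r \<in> {0..1}"
    have "dist ((x t $ 1)\<^sup>2 / 2) ((x r $ 1)\<^sup>2 / 2) = \<bar>(x t $ 1 + x r $ 1) / 2\<bar> * \<bar>x t $ 1 - x r $ 1\<bar>"
      unfolding dist_real_def abs_mult[symmetric]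
      by (rule arg_cong[where f = abs]) (simp add: power2_eq_square field_simps)
    also have "\<dots> \<le> B * (L * dist t r)"
      using lipschitz_onD[OF lip_nth tr, of 1] B[OF tr(1)] B[OF tr(2)] \<open>0 < B\<close>
      by (intro mult_mono) (auto simp: dist_real_def)
    finally show "dist ((x t $ 1)\<^sup>2 / 2) ((x r $ 1)\<^sup>2 / 2) \<le> B * L * dist t r"
      by (simp add: mult.assoc)
  qed (use \<open>0 < B\<close> \<open>0 \<le> L\<close> in simp)
  moreover have "((\<lambda>r. (x r $ 1)\<^sup>2 / 2) has_vector_derivative x t $ 1 * p t $ 1) (at t within {0..1})"
    if "t \<in> {0..1} - N" for t
    using x'_nth[OF that, of 1] unfolding has_real_derivative_iff_has_vector_derivative[symmetric]
    by (auto intro!: derivative_eq_intros)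
  ultimately have xp1: "((\<lambda>t. x t $ 1 * p t $ 1) has_integral ((vR $ 1)\<^sup>2 / 2 - (vL $ 1)\<^sup>2 / 2)) {0..1}"
    using lipschitz_on_has_integral_derivative[OF _ _ N, of 0 1 "B * L" "\<lambda>r. (x r $ 1)\<^sup>2 / 2"]
    by (simp add: ends)

  \<comment> \<open>The hypothesis is about the value of \<open>integral\<close>, which is an honest integral only if the
    product is integrable. This holds since \<open>x\<^sub>1\<close> is continuous and \<open>x\<^sub>2'\<close> is integrable and
    bounded by \<open>L\<close>; the zero on \<open>N\<close> makes the bound hold everywhere.\<close>
  define q where "q t = (if t \<in> N then 0 else p t $ 2)" for t
  have "q integrable_on {0..1}"
    using has_integral_spike[OF N _ p_int[of 2], of q] by (auto simp: q_def integrable_on_def)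
  moreover have "norm (q t) \<le> L" if "t \<in> {0..1}" for t
    using lipschitz_on_abs_derivative_le[OF _ lip_nth that, of 2 "p t $ 2"] x'_nth[of t 2] that \<open>0 \<le> L\<close>
    by (auto simp: q_def has_real_derivative_iff_has_vector_derivative)
  ultimately have "q absolutely_integrable_on {0..1}"
    by (intro absolutely_integrable_integrable_bound[where g = "\<lambda>_. L"]) auto
  then have "(\<lambda>t. x t $ 1 * q t) absolutely_integrable_on {0..1}"
    using x_cont x_bdd
    by (intro absolutely_integrable_bounded_measurable_product_real
        continuous_imp_measurable_on_sets_lebesgue) auto
  then have "(\<lambda>t. x t $ 1 * q t) integrable_on {0..1}"
    by (rule set_lebesgue_integral_eq_integral)
  then have xq: "((\<lambda>t. x t $ 1 * q t) has_integral integral {0..1} (\<lambda>t. x t $ 1 * q t)) {0..1}"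
    by (rule integrable_integral)
  have "integral {0..1} (\<lambda>t. x t $ 1 * q t) = integral {0..1} (\<lambda>t. x t $ 1 * path_deriv (\<lambda>r. x r $ 2) t)"
  proof (rule integral_spike[OF N])
    fix t assume t: "t \<in> {0..1} - N"
    have "path_deriv (\<lambda>r. x r $ 2) t = p t $ 2"
      unfolding path_deriv_def cbox_interval[symmetric]
      using x'_nth[OF t, of 2] t by (intro vector_derivative_within_cbox) auto
    then show "x t $ 1 * path_deriv (\<lambda>r. x r $ 2) t = x t $ 1 * q t"
      using t by (simp add: q_def)
  qed
  also have "\<dots> = s * (\<sigma>R - \<sigma>L)"
    using cond by (simp add: x_def s)
  finally have xp2: "((\<lambda>t. x t $ 1 * p t $ 2) has_integral s * (\<sigma>R - \<sigma>L)) {0..1}"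
    using has_integral_spike[OF N _ xq, of "\<lambda>t. x t $ 1 * p t $ 2"] by (simp add: q_def)

  have speed: "s * (uR - uL) = (uR\<^sup>2 / 2 - uL\<^sup>2 / 2) - (\<sigma>R - \<sigma>L)"
    using neq by (simp add: s)
  define G where "G t = ((- s) *\<^sub>R mat 1 + coeff_matrix (x t)) *v p t" for t
  have G1: "G t $ 1 = x t $ 1 * p t $ 1 - s * p t $ 1 - p t $ 2" for t
    by (simp add: G_def matrix_vector_mult_def sum_2 coeff_matrix_def mat_def algebra_simps)
  have G2: "G t $ 2 = x t $ 1 * p t $ 2 - s * p t $ 2" for t
    by (simp add: G_def matrix_vector_mult_def sum_2 coeff_matrix_def mat_def algebra_simps)
  have "((\<lambda>t. G t $ 1) has_integral 0) {0..1}"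
    unfolding G1
    using has_integral_diff[OF has_integral_diff[OF xp1 has_integral_mult_right[OF p_int[of 1], of s]] p_int[of 2]]
    by (simp add: vL vR speed)
  moreover have "((\<lambda>t. G t $ 2) has_integral 0) {0..1}"
    unfolding G2 using has_integral_diff[OF xp2 has_integral_mult_right[OF p_int[of 2], of s]]
    by (simp add: vL vR)
  ultimately have "((\<lambda>t. G t $ i) has_integral 0) {0..1}" for i
    using exhaust_2[of i] by auto
  then have "(G has_integral 0) {0..1}"
    unfolding has_integral_componentwise_iff[of G]
    by (auto simp: Basis_vec_def inner_axis)
  then show ?thesis
    unfolding G_def[abs_def] p_def x_def[abs_def] .
qed

end
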